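(* Let $R(z)=R_0+zC(I-zA)^{-1}B+\gamma(zI-\alpha)^{-1}\beta$ be an $m\times m$ rational matrix function with $A$ and $\alpha$ stable and with no poles and no zeros on the unit circle $\mathbb{T}$, let $\Psi(z)$ be the invertible outer function defined from this realization in the context, and put $\Xi(z)=R(z)\Psi(z)^{-1}$. Then the rational function $\Xi(z)$ is unitary for each $z\in\mathbb{T}$, and the functions $R(z)$ and $\Xi(z)$ have the same right Wiener-Hopf indices.
   Context: All matrices are complex; a square matrix is stable if all its eigenvalues lie in the open unit disc. For a rational matrix function $F(z)$, $F^*(z)=F(1/\bar z)^*$. Zeros of a square rational matrix function are the poles of its inverse. An invertible outer function is a rational $m\times m$ matrix function with no poles and no zeros on the closed unit disc. Definition of $\Psi$: let $P_+$ and $P_-$ be the unique solutions of $P_+-A^*P_+A=C^*C$ and $P_--\alpha^*P_-\alpha=\gamma^*\gamma$, and put \[ \widetilde A=\begin{bmatrix}A^*& C^*\gamma\\0&\alpha\end{bmatrix},\quad \widetilde B=\begin{bmatrix}C^*R_0+A^*P_+B\\ \beta\end{bmatrix},\quad \widetilde C=\begin{bmatrix}B^*& R_0^*\gamma+\beta^*P_-\alpha\end{bmatrix},\quad \widetilde D=R_0^*R_0+B^*P_+B+\beta^*P_-\beta. \] Let $Q$ be the unique stabilizing solution of \[ Q-\widetilde AQ\widetilde A^*=(\widetilde B-\widetilde AQ\widetilde C^* )(\widetilde D-\widetilde CQ\widetilde C^* )^{-1}(\widetilde B^*-\widetilde CQ\widetilde A^* ), \] i.e. the Hermitian solution for which $\widetilde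 D-\widetilde CQ\widetilde C^*$ is positive definite and $\widetilde A^*-\widetilde C^*(\widetilde D-\widetilde CQ\widetilde C^* )^{-1}(\widetilde B^*-\widetilde CQ\widetilde A^* )$ is stable. Define $D=(\widetilde D-\widetilde CQ\widetilde C^* )^{1/2}$, $C_0=\widetilde B^*-\widetilde CQ\widetilde A^*$, $B_0=\widetilde C^*$. Then $\Psi(z)=D+zD^{-1}C_0(I-z\widetilde A^* )^{-1}B_0$; it is an invertible outer function with $R^*(z)R(z)=\Psi^*(z)\Psi(z)$. Right Wiener-Hopf indices: an $m\times m$ rational matrix function $F(z)$ with no poles and no zeros on $\mathbb{T}$ admits a right Wiener-Hopf factorization $F(z)=W_-(z)D_F(z)W_+(z)$, where $W_-$, $W_+$ are rational $m\times m$ matrix functions, $W_-$ has no poles and no zeros outside the open unit disc including infinity, $W_+$ has no poles and no zeros on the closed unit disc, and $D_F(z)=\operatorname{diag}(z^{-\alpha_1},\dots,z^{-\alpha_s})\oplus I_k\oplus\operatorname{diag}(z^{\omega_t},\dots,z^{\omega_1})$ with integers $-\alpha_1\le\cdots\le-\alpha_s<0$, $0<\omega_t\le\cdots\le\omega_1$, $m=s+k+t$. The numbers $\alpha_j$ and $\omega_j$ (uniquely determined by $F$) are called the right Wiener-Hopf indices of $F$. *)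

theory Defs
  imports
    "HOL-Analysis.Analysis"
    "HOL-Computational_Algebra.Polynomial"
    "HOL-Computational_Algebra.Fraction_Field"
begin

definition adj :: "complex^'n^'m \<Rightarrow> complex^'m^'n" where
  "adj M = map_matrix cnj (transpose M)"

definition hermitian :: "complex^'n^'n \<Rightarrow> bool" where
  "hermitian M \<longleftrightarrow> adj M = M"

definition pos_def :: "complex^'n^'n \<Rightarrow> bool" where
  "pos_def M \<longleftrightarrow> hermitian M \<and>
     (\<forall>v. v \<noteq> 0 \<longrightarrow> 0 < Re (\<Sum>i\<in>UNIV. cnj (v $ i) * (M *v v) $ i))"

definition unitary :: "complex^'n^'n \<Rightarrow> bool" where
  "unitary U \<longleftrightarrow> adj U ** U = mat 1 \<and> U ** adj U = mat 1"

definition is_eigenvalue :: "complex^'n^'n \<Rightarrow> complex \<Rightarrow> bool" where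
  "is_eigenvalue M l \<longleftrightarrow> (\<exists>v. v \<noteq> 0 \<and> M *v v = l *s v)"

definition stable :: "complex^'n^'n \<Rightarrow> bool" where
  "stable M \<longleftrightarrow> (\<forall>l. is_eigenvalue M l \<longrightarrow> norm l < 1)"

definition block_mat ::
  "complex^'n^'k \<Rightarrow> complex^'p^'k \<Rightarrow> complex^'n^'l \<Rightarrow> complex^'p^'l \<Rightarrow> complex^('n + 'p)^('k + 'l)"
where
  "block_mat M11 M12 M21 M22 = (\<chi> i j.
     case i of
       Inl a \<Rightarrow> (case j of Inl b \<Rightarrow> M11 $ a $ b | Inr b \<Rightarrow> M12 $ a $ b)
     | Inr a \<Rightarrow> (case j of Inl b \<Rightarrow> M21 $ a $ b | Inr b \<Rightarrow> M22 $ a $ b))"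

definition block_col :: "complex^'m^'k \<Rightarrow> complex^'m^'l \<Rightarrow> complex^'m^('k + 'l)" where
  "block_col M1 M2 = (\<chi> i j. case i of Inl a \<Rightarrow> M1 $ a $ j | Inr a \<Rightarrow> M2 $ a $ j)"

definition block_row :: "complex^'n^'m \<Rightarrow> complex^'p^'m \<Rightarrow> complex^('n + 'p)^'m" where
  "block_row M1 M2 = (\<chi> i j. case j of Inl b \<Rightarrow> M1 $ i $ b | Inr b \<Rightarrow> M2 $ i $ b)"

definition stabilizing_solution ::
  "complex^'n^'n \<Rightarrow> complex^'m^'n \<Rightarrow> complex^'n^'m \<Rightarrow> complex^'m^'m \<Rightarrow> complex^'n^'n \<Rightarrow> bool"
where
  "stabilizing_solution At Bt Ct Dt Q \<longleftrightarrow>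
     hermitian Q \<and>
     Q - At ** Q ** adj At =
       (Bt - At ** Q ** adj Ct) ** matrix_inv (Dt - Ct ** Q ** adj Ct) ** (adj Bt - Ct ** Q ** adj At) \<and>
     pos_def (Dt - Ct ** Q ** adj Ct) \<and>
     stable (adj At - adj Ct ** matrix_inv (Dt - Ct ** Q ** adj Ct) ** (adj Bt - Ct ** Q ** adj At))"

(* A rational matrix function is a matrix over the field C(z), so that
   equality, products and inverses are those of rational functions. *)
type_synonym ratfun = "complex poly fract"

definition ratz :: ratfun where
  "ratz = Fraction_Field.Fract [:0, 1:] 1"

definition ratconst :: "complex \<Rightarrow> ratfun" where
  "ratconst c = Fraction_Field.Fract [:c:] 1"

definition const_mat :: "complex^'n^'m \<Rightarrow> ratfun^'n^'m" where
  "const_mat M = map_matrix ratconst M"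

definition rat_pole :: "ratfun \<Rightarrow> complex \<Rightarrow> bool" where
  "rat_pole f w \<longleftrightarrow> \<not> (\<exists>p q. poly q w \<noteq> 0 \<and> f = Fraction_Field.Fract p q)"

definition rat_pole_inf :: "ratfun \<Rightarrow> bool" where
  "rat_pole_inf f \<longleftrightarrow> \<not> (\<exists>p q. q \<noteq> 0 \<and> degree p \<le> degree q \<and> f = Fraction_Field.Fract p q)"

(* Meaningful only at points that are not poles. *)
definition rat_eval :: "ratfun \<Rightarrow> complex \<Rightarrow> complex" where
  "rat_eval f w =
     (THE v. \<exists>p q. poly q w \<noteq> 0 \<and> f = Fraction_Field.Fract p q \<and> v = poly p w / poly q w)"

definition mat_pole :: "ratfun^'n^'m \<Rightarrow> complex \<Rightarrow> bool" where
  "mat_pole F w \<longleftrightarrow> (\<exists>i j. rat_pole (F $ i $ j) w)"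

definition mat_pole_inf :: "ratfun^'n^'m \<Rightarrow> bool" where
  "mat_pole_inf F \<longleftrightarrow> (\<exists>i j. rat_pole_inf (F $ i $ j))"

definition mat_eval :: "ratfun^'n^'m \<Rightarrow> complex \<Rightarrow> complex^'n^'m" where
  "mat_eval F w = map_matrix (\<lambda>f. rat_eval f w) F"

(* Zeros are the poles of the inverse; they are only considered for functions
   that are invertible over C(z), i.e. with determinant not identically zero. *)
definition mat_zero :: "ratfun^'m^'m \<Rightarrow> complex \<Rightarrow> bool" where
  "mat_zero F w \<longleftrightarrow> mat_pole (matrix_inv F) w"

definition mat_zero_inf :: "ratfun^'m^'m \<Rightarrow> bool" where
  "mat_zero_inf F \<longleftrightarrow> mat_pole_inf (matrix_inv F)"

definition no_poles_zeros_on :: "ratfun^'m^'m \<Rightarrow> complex set \<Rightarrow> bool" where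
  "no_poles_zeros_on F S \<longleftrightarrow> invertible F \<and> (\<forall>w\<in>S. \<not> mat_pole F w \<and> \<not> mat_zero F w)"

definition no_poles_zeros_inf :: "ratfun^'m^'m \<Rightarrow> bool" where
  "no_poles_zeros_inf F \<longleftrightarrow> invertible F \<and> \<not> mat_pole_inf F \<and> \<not> mat_zero_inf F"

definition realization_fun ::
  "complex^'m^'m \<Rightarrow> complex^'n^'n \<Rightarrow> complex^'m^'n \<Rightarrow> complex^'n^'m \<Rightarrow>
   complex^'p^'p \<Rightarrow> complex^'m^'p \<Rightarrow> complex^'p^'m \<Rightarrow> ratfun^'m^'m"
where
  "realization_fun R0 A B C \<alpha> \<beta> \<gamma> =
     const_mat R0
     + mat ratz ** const_mat C ** matrix_inv (mat 1 - mat ratz ** const_mat A) ** const_mat B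
     + const_mat \<gamma> ** matrix_inv (mat ratz - const_mat \<alpha>) ** const_mat \<beta>"

definition outer_fun ::
  "complex^'m^'m \<Rightarrow> complex^'n^'m \<Rightarrow> complex^'n^'n \<Rightarrow> complex^'m^'n \<Rightarrow> ratfun^'m^'m"
where
  "outer_fun D C0 At B0 =
     const_mat D
     + mat ratz ** const_mat (matrix_inv D) ** const_mat C0
         ** matrix_inv (mat 1 - mat ratz ** const_mat (adj At)) ** const_mat B0"

(* The middle factor diag(z^k_0, ..., z^k_(m-1)) for a list ks of exponents; the map pos
   numbers the elements of the index type by 0, ..., m-1. *)
definition wh_diag :: "('m::finite \<Rightarrow> nat) \<Rightarrow> int list \<Rightarrow> ratfun^'m^'m" where
  "wh_diag pos ks = (\<chi> i j. if i = j then ratz powi (ks ! pos i) else 0)"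

(* as = [alpha_1, ..., alpha_s] and ws = [omega_1, ..., omega_t], both listed in
   decreasing order.  The numbering pos of the index type is immaterial: changing it amounts
   to multiplying W_- and W_+ by constant permutation matrices. *)
definition right_WH_indices :: "ratfun^'m^'m \<Rightarrow> int list \<Rightarrow> int list \<Rightarrow> bool" where
  "right_WH_indices F as ws \<longleftrightarrow>
     sorted (map uminus as) \<and> (\<forall>a\<in>set as. - a < 0) \<and>
     sorted (rev ws) \<and> (\<forall>w\<in>set ws. 0 < w) \<and>
     (\<exists>k Wm Wp pos.
        CARD('m) = length as + k + length ws \<and>
        bij_betw pos (UNIV :: 'm set) {..<CARD('m)} \<and>
        no_poles_zeros_on Wm {z. 1 \<le> norm z} \<and> no_poles_zeros_inf Wm \<and>
        no_poles_zeros_on Wp {z. norm z \<le> 1} \<and>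
        F = Wm ** wh_diag pos (map uminus as @ replicate k 0 @ rev ws) ** Wp)"

end

theory Submission
  imports Defs "HOL-Computational_Algebra.Fundamental_Theorem_Algebra"
begin

text \<open>
  On the unit circle the Gram matrix of the given function coincides with that of the outer
  function, \<open>R(w)\<^sup>* R(w) = \<Psi>(w)\<^sup>* \<Psi>(w)\<close>, and \<open>\<Psi>\<close> is invertible on the closed
  disc. The quotient \<open>\<Xi> = R \<Psi>\<^sup>-\<^sup>1\<close> is therefore an isometry, hence unitary, at every point of
  the circle. Moreover \<open>\<Psi>\<close> and its inverse are analytic on the closed disc, so a
  Wiener-Hopf factorization of \<open>R\<close> becomes one of \<open>\<Xi>\<close>, and conversely, when \<open>\<Psi>\<^sup>-\<^sup>1\<close> or \<open>\<Psi>\<close>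
  is absorbed into the factor \<open>W\<^sub>+\<close>; the middle factor is untouched
  (\<open>right_WH_indices_mult_outer_iff\<close>).

  Both Gram matrices are computed at a fixed point \<open>w\<close> of the circle from the states of the
  realizations. A state \<open>x\<close> satisfies a recursion such as \<open>x = B + A (w x)\<close>, and since
  \<open>|w| = 1\<close> the form \<open>x\<^sup>* P x\<close> equals \<open>(w x)\<^sup>* P (w x)\<close>. Inserting the recursion
  into this equality and using the Stein equation for \<open>P\<close> eliminates all terms that are quadratic
  in the state. For \<open>R\<close> this is done with \<open>P\<^sub>+\<close> for the part analytic in the disc
  and with \<open>P\<^sub>-\<close> for the part analytic outside; the mixed terms become linear by means of the
  second component of the state of \<open>\<Psi>\<close> (\<open>two_sided_gram\<close>). For \<open>\<Psi>\<close> the Riccati equation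
  takes the place of the Stein equation (\<open>spectral_factor_gram\<close>). Both computations end in the
  same expression, the sum of a constant, a term linear in the state of \<open>\<Psi>\<close>, and its adjoint.

  The computation needs \<open>P\<^sub>+\<close> and \<open>P\<^sub>-\<close> to be Hermitian. As the adjoint of a solution of the Stein
  equation is again a solution, this follows from uniqueness (\<open>stein_homogeneous\<close>), which is
  a Liouville argument for rational functions. That \<open>\<Psi>\<close> has no zeros in the closed disc is the
  stabilizing property of \<open>Q\<close>: a kernel vector of \<open>\<Psi>(w)\<close> drives the
  state through the closed-loop matrix (\<open>outer_value_invertible\<close>).
\<close>

section \<open>Matrix algebra\<close>

lemma matrix_add_distrib_right:
  fixes A B :: "'a::semiring_1^'n^'m" and C :: "'a^'p^'n"
  shows "(A + B) ** C = A ** C + B ** C"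
  by (vector matrix_matrix_mult_def sum.distrib[symmetric] field_simps)

lemma matrix_diff_distrib_left:
  fixes A :: "'a::ring_1^'n^'m" and B C :: "'a^'p^'n"
  shows "A ** (B - C) = A ** B - A ** C"
  by (simp add: vec_eq_iff matrix_matrix_mult_def sum_subtractf right_diff_distrib)

lemma matrix_diff_distrib_right:
  fixes A B :: "'a::ring_1^'n^'m" and C :: "'a^'p^'n"
  shows "(A - B) ** C = A ** C - B ** C"
  by (simp add: vec_eq_iff matrix_matrix_mult_def sum_subtractf left_diff_distrib)

lemma matrix_mult_minus_left:
  fixes A :: "'a::ring_1^'n^'m" and C :: "'a^'p^'n"
  shows "(- A) ** C = - (A ** C)"
  by (simp add: vec_eq_iff matrix_matrix_mult_def sum_negf)

lemma matrix_mult_zero_left [simp]: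
  fixes C :: "'a::semiring_1^'p^'n"
  shows "(0 :: 'a^'n^'m) ** C = 0"
  by (simp add: vec_eq_iff matrix_matrix_mult_def)

lemmas matrix_distribs =
  matrix_add_ldistrib matrix_add_distrib_right matrix_diff_distrib_left matrix_diff_distrib_right

lemma mat_mult_nth:
  fixes X :: "'a::semiring_1^'n^'m"
  shows "(mat c ** X) $ i $ j = c * X $ i $ j"
  by (simp add: matrix_matrix_mult_def mat_def if_distrib if_distribR sum.delta' cong: if_cong)

lemma mult_mat_nth:
  fixes X :: "'a::semiring_1^'n^'m"
  shows "(X ** mat c) $ i $ j = X $ i $ j * c"
  by (simp add: matrix_matrix_mult_def mat_def if_distrib if_distribR sum.delta sum.delta' cong: if_cong)

lemma mat_commute:
  fixes X :: "'a::comm_semiring_1^'n^'m"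
  shows "X ** mat c = mat c ** X"
  by (simp add: vec_eq_iff mat_mult_nth mult_mat_nth mult.commute)

lemma mat_mult_vec:
  fixes v :: "'a::semiring_1^'n"
  shows "mat c *v v = c *s v"
  by (simp add: vec_eq_iff matrix_vector_mult_def mat_def if_distrib if_distribR sum.delta sum.delta' cong: if_cong)

lemma matrix_inv_mult:
  assumes "invertible (F :: 'a::field^'n^'n)"
  shows "F ** matrix_inv F = mat 1" "matrix_inv F ** F = mat 1"
proof -
  from assms have "F ** matrix_inv F = mat 1 \<and> matrix_inv F ** F = mat 1"
    unfolding invertible_def matrix_inv_def by (rule someI_ex)
  then show "F ** matrix_inv F = mat 1" "matrix_inv F ** F = mat 1" by auto
qed

lemma matrix_inv_eqI:
  fixes F G :: "'a::field^'n^'n"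
  assumes "G ** F = mat 1"
  shows "invertible F" "matrix_inv F = G"
proof -
  show inv: "invertible F" using assms invertible_left_inverse by blast
  have "G ** (F ** matrix_inv F) = matrix_inv F"
    using assms by (simp add: matrix_mul_assoc)
  then show "matrix_inv F = G" by (simp add: matrix_inv_mult inv)
qed

lemma invertible_matrix_inv:
  "invertible (F :: 'a::field^'n^'n) \<Longrightarrow> invertible (matrix_inv F)"
  "invertible F \<Longrightarrow> matrix_inv (matrix_inv F) = F"
  using matrix_inv_eqI[OF matrix_inv_mult(1)] by auto

lemma matrix_inv_of_mult:
  fixes F G :: "'a::field^'n^'n"
  assumes "invertible F" "invertible G"
  shows "matrix_inv (F ** G) = matrix_inv G ** matrix_inv F"
proof (rule matrix_inv_eqI(2))
  have "matrix_inv G ** matrix_inv F ** (F ** G) = matrix_inv G ** (matrix_inv F ** F) ** G"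
    by (simp only: matrix_mul_assoc)
  then show "matrix_inv G ** matrix_inv F ** (F ** G) = mat 1"
    by (simp add: matrix_inv_mult assms)
qed

lemma invertible_iff_kernel:
  fixes M :: "complex^'n^'n"
  shows "invertible M \<longleftrightarrow> (\<forall>v. M *v v = 0 \<longrightarrow> v = 0)"
  unfolding invertible_left_inverse by (rule matrix_left_invertible_ker)

section \<open>Adjoints and block matrices\<close>

lemma adj_nth: "adj M $ i $ j = cnj (M $ j $ i)"
  by (simp add: adj_def transpose_def)

lemma adj_adj [simp]: "adj (adj M) = M"
  by (simp add: vec_eq_iff adj_nth)

lemma adj_0 [simp]: "adj 0 = 0"
  by (simp add: vec_eq_iff adj_nth)

lemma adj_add: "adj (M + N) = adj M + adj N"
  and adj_diff: "adj (M - N) = adj M - adj N"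
  by (simp_all add: vec_eq_iff adj_nth)

lemma adj_mult: "adj (M ** N) = adj N ** adj M"
  by (simp add: vec_eq_iff adj_nth matrix_matrix_mult_def mult.commute)

lemma adj_mat: "adj (mat c) = mat (cnj c)"
  by (simp add: vec_eq_iff adj_nth mat_def)

lemma invertible_adj:
  fixes M :: "complex^'n^'n"
  assumes "invertible M"
  shows "invertible (adj M)"
proof (rule matrix_inv_eqI(1))
  show "adj (matrix_inv M) ** adj M = mat 1"
    by (simp add: adj_mult[symmetric] matrix_inv_mult assms adj_mat)
qed

lemma sum_UNIV_Plus:
  "(\<Sum>i\<in>(UNIV :: ('n::finite + 'p::finite) set). f i) =
    (\<Sum>i\<in>UNIV. f (Inl i)) + (\<Sum>i\<in>UNIV. (f (Inr i) :: 'a::comm_monoid_add))"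
  by (simp add: UNIV_Plus_UNIV[symmetric] sum.Plus del: UNIV_Plus_UNIV)

lemma block_mat_mult_col:
  "block_mat M11 M12 M21 M22 ** block_col X Y =
     block_col (M11 ** X + M12 ** Y) (M21 ** X + M22 ** Y)"
  by (auto simp: vec_eq_iff block_mat_def block_col_def matrix_matrix_mult_def sum_UNIV_Plus
      split: sum.split)

lemma block_row_mult_col: "block_row M N ** block_col X Y = M ** X + N ** Y"
  by (auto simp: vec_eq_iff block_row_def block_col_def matrix_matrix_mult_def sum_UNIV_Plus)

lemma block_col_add: "block_col X Y + block_col X' Y' = block_col (X + X') (Y + Y')"
  by (auto simp: vec_eq_iff block_col_def split: sum.split)

lemma mult_block_col: "mat c ** block_col X Y = block_col (mat c ** X) (mat c ** Y)"
  by (auto simp: vec_eq_iff block_col_def mat_mult_nth split: sum.split)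

lemma adj_block_mat:
  "adj (block_mat M11 M12 M21 M22) = block_mat (adj M11) (adj M21) (adj M12) (adj M22)"
  by (auto simp: vec_eq_iff block_mat_def adj_nth split: sum.split)

lemma adj_block_col: "adj (block_col M N) = block_row (adj M) (adj N)"
  and adj_block_row: "adj (block_row M' N') = block_col (adj M') (adj N')"
  by (auto simp: vec_eq_iff block_row_def block_col_def adj_nth split: sum.split)

section \<open>Stable matrices\<close>

lemma is_eigenvalue_iff:
  "is_eigenvalue M l \<longleftrightarrow> \<not> invertible (M - mat l)"
  by (auto simp: is_eigenvalue_def invertible_iff_kernel matrix_vector_mult_diff_rdistrib mat_mult_vec)

lemma stable_adj:
  assumes "stable M"
  shows "stable (adj M)"
  unfolding stable_def
proof (intro allI impI)
  fix l assume "is_eigenvalue (adj M) l"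
  then have "\<not> invertible (adj (M - mat (cnj l)))"
    by (simp add: is_eigenvalue_iff adj_diff adj_mat)
  then have "is_eigenvalue M (cnj l)"
    using invertible_adj is_eigenvalue_iff by blast
  then show "norm l < 1" using assms by (auto simp: stable_def)
qed

lemma stable_block_triangular:
  assumes "stable M" "stable N"
  shows "stable (block_mat M K 0 N)"
  unfolding stable_def
proof (intro allI impI)
  fix l assume "is_eigenvalue (block_mat M K 0 N) l"
  then obtain v where v: "v \<noteq> 0" "block_mat M K 0 N *v v = l *s v"
    by (auto simp: is_eigenvalue_def)
  define x y where "x = (\<chi> i. v $ Inl i)" and "y = (\<chi> i. v $ Inr i)"
  have N: "N *v y = l *s y"
    using v(2) unfolding vec_eq_iff y_def
    by (auto simp: block_mat_def matrix_vector_mult_def sum_UNIV_Plus dest: spec[of _ "Inr _"])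
  have M: "M *v x + K *v y = l *s x"
    using v(2) unfolding vec_eq_iff y_def x_def
    by (auto simp: block_mat_def matrix_vector_mult_def sum_UNIV_Plus dest: spec[of _ "Inl _"])
  show "norm l < 1"
  proof (cases "y = 0")
    case False
    then show ?thesis using N assms(2) by (auto simp: stable_def is_eigenvalue_def)
  next
    case True
    have "x \<noteq> 0"
    proof
      assume "x = 0"
      have "v $ i = 0" for i
        using \<open>x = 0\<close> \<open>y = 0\<close> by (cases i) (auto simp: x_def y_def vec_eq_iff)
      then show False using v(1) by (simp add: vec_eq_iff)
    qed
    then show ?thesis using M True assms(1) by (auto simp: stable_def is_eigenvalue_def)
  qed
qed

text \<open>
  A nonzero solution would make \<open>1/w\<close> an eigenvalue, and that lies outside the open disc.
\<close>

lemma stable_fixpoint_zero: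
  assumes "stable M" "norm w \<le> 1" "x = w *s (M *v x)"
  shows "x = 0"
proof (rule ccontr)
  assume x: "x \<noteq> 0"
  then have w: "w \<noteq> 0" using assms(3) by auto
  have "M *v x = inverse w *s x"
    by (subst (2) assms(3)) (simp add: w vector_smult_assoc)
  then have "norm (inverse w) < 1"
    using assms(1) x unfolding stable_def is_eigenvalue_def by blast
  moreover have "1 \<le> inverse (norm w)" using assms(2) w by (simp add: one_le_inverse_iff)
  ultimately show False by (simp add: norm_inverse)
qed

lemma stable_invertible_disc:
  assumes "stable M" "norm w \<le> 1"
  shows "invertible (mat 1 - mat w ** M)"
  unfolding invertible_iff_kernel
proof (intro allI impI)
  fix v assume "(mat 1 - mat w ** M) *v v = 0"
  then have "v = w *s (M *v v)"
    by (simp add: matrix_vector_mult_diff_rdistrib matrix_vector_mul_assoc[symmetric] mat_mult_vec)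
  then show "v = 0" using stable_fixpoint_zero assms by blast
qed

lemma stable_invertible_exterior:
  assumes "stable M" "1 \<le> norm w"
  shows "invertible (mat w - M)"
proof -
  have "\<not> is_eigenvalue M w" using assms by (auto simp: stable_def)
  then show ?thesis
    by (auto simp: invertible_iff_kernel is_eigenvalue_def matrix_vector_mult_diff_rdistrib mat_mult_vec)
qed

section \<open>Values of rational matrix functions\<close>

text \<open>
  A relational form of evaluation, in the style of derivatives: one predicate says both that the
  function is regular at the point and what its value is, so that regularity and value of a
  compound expression are derived together.
\<close>

definition has_value :: "ratfun \<Rightarrow> complex \<Rightarrow> complex \<Rightarrow> bool" where
  "has_value f w v \<longleftrightarrow>
    (\<exists>p q. poly q w \<noteq> 0 \<and> f = Fraction_Field.Fract p q \<and> v = poly p w / poly q w)"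

lemma has_valueI:
  "poly q w \<noteq> 0 \<Longrightarrow> has_value (Fraction_Field.Fract p q) w (poly p w / poly q w)"
  by (auto simp: has_value_def)

lemma has_value_unique:
  assumes "has_value f w u" "has_value f w v"
  shows "u = v"
proof -
  obtain p q p' q' where *: "poly q w \<noteq> 0" "poly q' w \<noteq> 0"
    "Fraction_Field.Fract p q = Fraction_Field.Fract p' q'"
    "u = poly p w / poly q w" "v = poly p' w / poly q' w"
    using assms unfolding has_value_def by metis
  then have "p * q' = p' * q" by (subst (asm) eq_fract) auto
  then have "poly p w * poly q' w = poly p' w * poly q w" by (metis poly_mult)
  then have "poly p w / poly q w = poly p' w / poly q' w"
    using * by (simp add: frac_eq_eq)
  then show ?thesis using * by simp
qed

lemma rat_pole_iff: "rat_pole f w \<longleftrightarrow> (\<nexists>v. has_value f w v)"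
  by (auto simp: rat_pole_def has_value_def)

lemma rat_eval_eqI:
  assumes "has_value f w v"
  shows "rat_eval f w = v"
  unfolding rat_eval_def
  by (rule the_equality)
    (use assms in \<open>auto simp: has_value_def[symmetric] intro: has_value_unique[OF _ assms]\<close>)

lemma has_value_const: "has_value (ratconst c) w c"
  using has_valueI[of 1 w "[:c:]"] by (simp add: ratconst_def)

lemma has_value_ratz: "has_value ratz w w"
  using has_valueI[of 1 w "[:0, 1:]"] by (simp add: ratz_def)

lemma has_value_0: "has_value 0 w 0" and has_value_1: "has_value 1 w 1"
  using has_valueI[of 1 w 0] has_valueI[of 1 w 1]
  by (simp_all add: Zero_fract_def One_fract_def)

lemma has_value_add:
  assumes "has_value f w u" "has_value g w v"
  shows "has_value (f + g) w (u + v)"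
proof -
  from assms obtain p q p' q' where *: "poly q w \<noteq> 0" "poly q' w \<noteq> 0"
    "f = Fraction_Field.Fract p q" "g = Fraction_Field.Fract p' q'"
    "u = poly p w / poly q w" "v = poly p' w / poly q' w"
    unfolding has_value_def by metis
  then have "f + g = Fraction_Field.Fract (p * q' + p' * q) (q * q')"
    by (subst *(3), subst *(4), subst add_fract) auto
  moreover have "u + v = poly (p * q' + p' * q) w / poly (q * q') w"
    using * by (simp add: add_frac_eq)
  ultimately show ?thesis using * has_valueI[of "q * q'" w "p * q' + p' * q"] by simp
qed

lemma has_value_mult:
  assumes "has_value f w u" "has_value g w v"
  shows "has_value (f * g) w (u * v)"
proof -
  from assms obtain p q p' q' where *: "poly q w \<noteq> 0" "poly q' w \<noteq> 0"
    "f = Fraction_Field.Fract p q" "g = Fraction_Field.Fract p' q'"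
    "u = poly p w / poly q w" "v = poly p' w / poly q' w"
    using assms unfolding has_value_def by metis
  then show ?thesis using has_valueI[of "q * q'" w "p * p'"] by simp
qed

lemma has_value_minus:
  assumes "has_value f w u" shows "has_value (- f) w (- u)"
proof -
  have "ratconst (-1) = - 1"
    by (simp add: ratconst_def One_fract_def one_pCons)
  then show ?thesis using has_value_mult[OF has_value_const[of "-1"] assms] by simp
qed

lemma has_value_diff:
  "has_value f w u \<Longrightarrow> has_value g w v \<Longrightarrow> has_value (f - g) w (u - v)"
  using has_value_add[OF _ has_value_minus] by fastforce

lemma has_value_divide:
  assumes "has_value f w u" "has_value g w v" "v \<noteq> 0"
  shows "has_value (f / g) w (u / v)"
proof -
  from assms obtain p q p' q' where *: "poly q w \<noteq> 0" "poly q' w \<noteq> 0"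
    "f = Fraction_Field.Fract p q" "g = Fraction_Field.Fract p' q'"
    "u = poly p w / poly q w" "v = poly p' w / poly q' w"
    unfolding has_value_def by metis
  then show ?thesis using has_valueI[of "q * p'" w "p * q'"] assms(3) by simp
qed

lemma has_value_sum:
  "(\<And>i. i \<in> S \<Longrightarrow> has_value (f i) w (v i)) \<Longrightarrow> has_value (\<Sum>i\<in>S. f i) w (\<Sum>i\<in>S. v i)"
  by (induction S rule: infinite_finite_induct) (auto intro: has_value_0 has_value_add)

lemma has_value_prod:
  "(\<And>i. i \<in> S \<Longrightarrow> has_value (f i) w (v i)) \<Longrightarrow> has_value (\<Prod>i\<in>S. f i) w (\<Prod>i\<in>S. v i)"
  by (induction S rule: infinite_finite_induct) (auto intro: has_value_1 has_value_mult)

lemma has_value_of_int: "has_value (of_int k) w (of_int k)"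
proof (induction k rule: int_induct[where k = 0])
  case base
  show ?case by (simp add: has_value_0)
next
  case (step1 i)
  then show ?case using has_value_add[OF step1(2) has_value_1] by simp
next
  case (step2 i)
  then show ?case using has_value_diff[OF step2(2) has_value_1] by simp
qed

definition mat_has_value :: "ratfun^'n^'m \<Rightarrow> complex \<Rightarrow> complex^'n^'m \<Rightarrow> bool" where
  "mat_has_value F w M \<longleftrightarrow> (\<forall>i j. has_value (F $ i $ j) w (M $ i $ j))"

lemma mat_pole_iff: "mat_pole F w \<longleftrightarrow> (\<nexists>M. mat_has_value F w M)"
proof -
  have "\<exists>M. mat_has_value F w M" if "\<forall>i j. \<exists>v. has_value (F $ i $ j) w v"
    unfolding mat_has_value_def
    by (rule exI[of _ "\<chi> i j. SOME v. has_value (F $ i $ j) w v"])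
      (use that in \<open>auto intro: someI_ex\<close>)
  moreover have "\<forall>i j. \<exists>v. has_value (F $ i $ j) w v" if "mat_has_value F w M" for M
    using that unfolding mat_has_value_def by blast
  ultimately show ?thesis unfolding mat_pole_def rat_pole_iff by blast
qed

lemma mat_eval_eqI: "mat_has_value F w M \<Longrightarrow> mat_eval F w = M"
  by (simp add: mat_has_value_def mat_eval_def vec_eq_iff rat_eval_eqI)

lemma mat_has_value_unique: "mat_has_value F w M \<Longrightarrow> mat_has_value F w N \<Longrightarrow> M = N"
  using mat_eval_eqI by blast

lemma mat_has_value_const: "mat_has_value (const_mat M) w M"
  by (simp add: mat_has_value_def const_mat_def has_value_const)

lemma mat_has_value_ratz: "mat_has_value (mat ratz) w (mat w)"
  by (simp add: mat_has_value_def mat_def has_value_0 has_value_ratz)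

lemma mat_has_value_1: "mat_has_value (mat 1) w (mat 1)"
  by (simp add: mat_has_value_def mat_def has_value_0 has_value_1)

lemma mat_has_value_add:
  "mat_has_value F w M \<Longrightarrow> mat_has_value G w N \<Longrightarrow> mat_has_value (F + G) w (M + N)"
  by (simp add: mat_has_value_def has_value_add)

lemma mat_has_value_diff:
  "mat_has_value F w M \<Longrightarrow> mat_has_value G w N \<Longrightarrow> mat_has_value (F - G) w (M - N)"
  by (simp add: mat_has_value_def has_value_diff)

lemma mat_has_value_mult:
  "mat_has_value F w M \<Longrightarrow> mat_has_value G w N \<Longrightarrow> mat_has_value (F ** G) w (M ** N)"
  by (simp add: mat_has_value_def matrix_matrix_mult_def has_value_sum has_value_mult)

lemma has_value_det:
  fixes F :: "ratfun^'n^'n"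
  assumes "mat_has_value F w M"
  shows "has_value (det F) w (det M)"
  unfolding det_def
  by (intro has_value_sum has_value_mult has_value_prod has_value_of_int)
    (use assms in \<open>auto simp: mat_has_value_def\<close>)

text \<open>
  Cramer's rule writes the entries of the inverse as quotients of determinants, which keeps
  track of poles: only zeros of the determinant can produce them.
\<close>

lemma matrix_inv_cramer:
  fixes F :: "'a::field^'n^'n"
  assumes "invertible F"
  shows "matrix_inv F $ k $ l = det (\<chi> i j. if j = k then axis l 1 $ i else F $ i $ j) / det F"
proof -
  have "det F \<noteq> 0" using assms invertible_det_nz by blast
  moreover have "F *v (matrix_inv F *v axis l 1) = axis l 1"
    by (simp add: matrix_vector_mul_assoc matrix_inv_mult assms)
  ultimately have "matrix_inv F *v axis l 1 =
      (\<chi> k. det (\<chi> i j. if j = k then axis l 1 $ i else F $ i $ j) / det F)"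
    by (rule cramer[THEN iffD1])
  then have "(matrix_inv F *v axis l 1) $ k =
      det (\<chi> i j. if j = k then axis l 1 $ i else F $ i $ j) / det F"
    by simp
  moreover have "(matrix_inv F *v axis l 1) $ k = matrix_inv F $ k $ l"
    by (simp add: matrix_vector_mult_def axis_def if_distrib sum.delta sum.delta' cong: if_cong)
  ultimately show ?thesis by simp
qed

text \<open>
  An inverse over the field of rational functions is evaluated pointwise: invertibility at one
  regular point yields invertibility as a rational matrix function and excludes a zero there.
\<close>

lemma mat_has_value_inverse:
  fixes F :: "ratfun^'n^'n"
  assumes F: "mat_has_value F w M" and M: "invertible M"
  shows "invertible F" "mat_has_value (matrix_inv F) w (matrix_inv M)"
proof -
  have det: "has_value (det F) w (det M)" by (rule has_value_det[OF F])
  have nz: "det M \<noteq> 0" using M invertible_det_nz by blast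
  then have "det F \<noteq> 0" using det has_value_unique[OF has_value_0] by fastforce
  then show inv: "invertible F" using invertible_det_nz by blast
  have replaced: "mat_has_value (\<chi> i j. if j = k then axis l 1 $ i else F $ i $ j) w
      (\<chi> i j. if j = k then axis l 1 $ i else M $ i $ j)" for k l
    using F by (auto simp: mat_has_value_def axis_def has_value_0 has_value_1)
  then show "mat_has_value (matrix_inv F) w (matrix_inv M)"
    by (subst mat_has_value_def)
      (auto simp: matrix_inv_cramer M inv intro!: has_value_divide[OF has_value_det det nz] replaced)
qed

section \<open>Uniqueness for the Stein equation\<close>

text \<open>
  In a representation whose denominator has least degree, the denominator has no root: at a
  root \<open>w\<close>, regularity forces the numerator to vanish as well, and the factor \<open>z - w\<close> could be
  cancelled. A polynomial without roots is constant.
\<close>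

lemma ratfun_no_poles_imp_poly:
  assumes "\<And>w. \<not> rat_pole f w"
  obtains p where "f = Fraction_Field.Fract p 1"
proof -
  define S where "S = {n. \<exists>p q. q \<noteq> 0 \<and> f = Fraction_Field.Fract p q \<and> degree q = n}"
  have "S \<noteq> {}"
    by (cases f rule: Fract_cases) (auto simp: S_def)
  then have "\<exists>n. n \<in> S" by blast
  then have "(LEAST n. n \<in> S) \<in> S" by (rule LeastI_ex)
  then obtain p q where q: "q \<noteq> 0" and f: "f = Fraction_Field.Fract p q"
    and deg: "degree q = (LEAST n. n \<in> S)"
    by (auto simp: S_def)
  have no_root: "poly q w \<noteq> 0" for w
  proof
    assume root: "poly q w = 0"
    obtain p' q' where pq': "poly q' w \<noteq> 0" "f = Fraction_Field.Fract p' q'"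
      using assms[of w] by (auto simp: rat_pole_def)
    then have "q' \<noteq> 0" by auto
    then have "p * q' = p' * q" using f q pq' by (simp add: eq_fract)
    then have "poly p w * poly q' w = poly p' w * poly q w" by (metis poly_mult)
    then have "poly p w = 0" using root pq' by simp
    then obtain p1 where p1: "p = [:- w, 1:] * p1" by (auto simp: poly_eq_0_iff_dvd)
    obtain q1 where q1: "q = [:- w, 1:] * q1" using root by (auto simp: poly_eq_0_iff_dvd)
    have "q1 \<noteq> 0" using q q1 by auto
    moreover have "f = Fraction_Field.Fract p1 q1"
      using f q q1 p1 \<open>q1 \<noteq> 0\<close> by (simp add: eq_fract algebra_simps)
    ultimately have "degree q1 \<in> S" by (auto simp: S_def)
    then have "degree q \<le> degree q1" using deg by (simp add: Least_le)
    moreover have "degree q = Suc (degree q1)"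
      unfolding q1 using \<open>q1 \<noteq> 0\<close> by (subst degree_mult_eq) auto
    ultimately show False by simp
  qed
  then have "constant (poly q)" using fundamental_theorem_of_algebra by blast
  then have "degree q = 0" by (simp add: constant_degree)
  then obtain c where c: "q = [:c:]" by (meson degree_eq_zeroE)
  then have "c \<noteq> 0" using q by auto
  then have "f = Fraction_Field.Fract (smult (inverse c) p) 1"
    using f c by (simp add: eq_fract)
  then show ?thesis using that by blast
qed

lemma ratconst_mult: "ratconst (a * b) = ratconst a * ratconst b"
  by (simp add: ratconst_def mult.commute)

lemma ratconst_add: "ratconst (a + b) = ratconst a + ratconst b"
  by (simp add: ratconst_def)

lemma ratconst_sum: "ratconst (sum h S) = (\<Sum>k\<in>S. ratconst (h k))"
  by (induction S rule: infinite_finite_induct) (auto simp: ratconst_add, auto simp: ratconst_def Zero_fract_def)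

lemma const_mat_mult: "const_mat (M ** N) = const_mat M ** const_mat N"
  by (simp add: const_mat_def vec_eq_iff matrix_matrix_mult_def ratconst_mult ratconst_sum)

text \<open>
  The relation \<open>z X = M X + N\<close> with constant \<open>M\<close> and \<open>N\<close> is impossible for a polynomial matrix \<open>X \<noteq> 0\<close>:
  a nonzero column of degree \<open>d\<close> has degree \<open>d + 1\<close> on the left and at most \<open>d\<close> on the right. This
  plays the part of the condition at infinity in Liouville's theorem.
\<close>

lemma poly_matrix_shift_eq_zero:
  fixes X :: "complex poly^'k^'n" and M :: "complex^'n^'n" and N :: "complex^'k^'n"
  assumes "\<And>w. mat w ** (\<chi> i j. poly (X $ i $ j) w) = M ** (\<chi> i j. poly (X $ i $ j) w) + N"
  shows "X = 0"
proof (rule ccontr)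
  assume "X \<noteq> 0"
  then obtain i0 j0 where nz: "X $ i0 $ j0 \<noteq> 0" by (auto simp: vec_eq_iff)
  define d where "d = Max (range (\<lambda>i. degree (X $ i $ j0)))"
  have le: "degree (X $ i $ j0) \<le> d" for i by (simp add: d_def)
  have rel: "pCons 0 (X $ i $ j0) = (\<Sum>k\<in>UNIV. smult (M $ i $ k) (X $ k $ j0)) + [:N $ i $ j0:]"
    for i
  proof (rule poly_ext)
    fix w
    have "(mat w ** (\<chi> i j. poly (X $ i $ j) w)) $ i $ j0 =
        (M ** (\<chi> i j. poly (X $ i $ j) w) + N) $ i $ j0"
      by (simp only: assms)
    then show "poly (pCons 0 (X $ i $ j0)) w =
        poly ((\<Sum>k\<in>UNIV. smult (M $ i $ k) (X $ k $ j0)) + [:N $ i $ j0:]) w"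
      by (simp add: mat_mult_nth poly_sum) (simp add: matrix_matrix_mult_def)
  qed
  have "coeff (X $ i $ j0) d = 0" for i
  proof -
    have "coeff (X $ i $ j0) d = coeff (pCons 0 (X $ i $ j0)) (Suc d)" by simp
    also have "\<dots> = 0"
      unfolding rel using le by (simp add: coeff_sum coeff_eq_0 less_Suc_eq_le)
    finally show ?thesis .
  qed
  moreover have "d \<in> range (\<lambda>i. degree (X $ i $ j0))"
    unfolding d_def by (rule Max_in) auto
  ultimately obtain i where "degree (X $ i $ j0) = d" "X $ i $ j0 = 0"
    by (metis (no_types, lifting) imageE leading_coeff_0_iff)
  then have "d = 0" by simp
  then have "degree (X $ i0 $ j0) = 0" using le[of i0] by simp
  then show False using \<open>d = 0\<close> \<open>\<And>i. coeff (X $ i $ j0) d = 0\<close> nz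
    by (metis leading_coeff_0_iff)
qed

text \<open>
  If \<open>\<Delta> = A\<^sup>* \<Delta> A\<close>, then \<open>(z - A\<^sup>*) \<Delta> + A\<^sup>* \<Delta> (I - z A) = 0\<close>, that is,
  \<open>\<Delta> (I - z A)\<^sup>-\<^sup>1 = - (z - A\<^sup>*)\<^sup>-\<^sup>1 A\<^sup>* \<Delta>\<close>. By stability the left-hand side is regular
  on the closed disc and the right-hand side is regular outside the open disc, so this function has
  no poles and is a polynomial matrix; since it vanishes at infinity, it is zero, and so is \<open>\<Delta>\<close>.
\<close>

lemma stein_homogeneous:
  fixes A :: "complex^'n^'n" and \<Delta> :: "complex^'n^'n"
  assumes A: "stable A" and eq: "\<Delta> = adj A ** \<Delta> ** A"
  shows "\<Delta> = 0"
proof -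
  let ?I = "mat 1 - mat ratz ** const_mat A"
  let ?J = "mat ratz - const_mat (adj A)"
  define X where "X = const_mat \<Delta> ** matrix_inv ?I"
  have I: "mat_has_value ?I w (mat 1 - mat w ** A)" for w
    by (intro mat_has_value_diff mat_has_value_mult mat_has_value_1 mat_has_value_ratz
        mat_has_value_const)
  have J: "mat_has_value ?J w (mat w - adj A)" for w
    by (intro mat_has_value_diff mat_has_value_ratz mat_has_value_const)
  have invI: "invertible ?I"
    by (rule mat_has_value_inverse(1)[OF I stable_invertible_disc[OF A, of 0]]) simp
  have invJ: "invertible ?J"
    by (rule mat_has_value_inverse(1)[OF J stable_invertible_exterior[OF stable_adj[OF A], of 1]]) simp
  have eq': "const_mat \<Delta> = const_mat (adj A) ** const_mat \<Delta> ** const_mat A"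
    by (subst eq) (simp add: const_mat_mult)
  have XI: "X ** ?I = const_mat \<Delta>"
    by (simp add: X_def matrix_mul_assoc[symmetric] matrix_inv_mult[OF invI])
  have "?J ** const_mat \<Delta> + const_mat (adj A) ** const_mat \<Delta> ** ?I =
      mat ratz ** const_mat \<Delta> - mat ratz ** (const_mat (adj A) ** const_mat \<Delta> ** const_mat A)"
    by (simp add: matrix_distribs matrix_mul_assoc mat_commute)
  then have "?J ** const_mat \<Delta> + const_mat (adj A) ** const_mat \<Delta> ** ?I = 0"
    by (simp only: eq'[symmetric] diff_self)
  then have "?J ** (X ** ?I) = - (const_mat (adj A) ** const_mat \<Delta>) ** ?I"
    unfolding XI matrix_mult_minus_left by (rule eq_neg_iff_add_eq_0[THEN iffD2])
  then have "?J ** X ** ?I ** matrix_inv ?I =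
      - (const_mat (adj A) ** const_mat \<Delta>) ** ?I ** matrix_inv ?I"
    by (simp only: matrix_mul_assoc)
  then have JX: "?J ** X = - (const_mat (adj A) ** const_mat \<Delta>)"
    by (simp add: matrix_mul_assoc[symmetric] matrix_inv_mult[OF invI])
  then have X_alt: "X = matrix_inv ?J ** - (const_mat (adj A) ** const_mat \<Delta>)"
    by (metis matrix_inv_mult(2)[OF invJ] matrix_mul_assoc matrix_mul_lid)
  have AD: "mat_has_value (- (const_mat (adj A) ** const_mat \<Delta>)) w (- (adj A ** \<Delta>))" for w
    using mat_has_value_const[of "adj A ** \<Delta>" w]
    by (simp add: mat_has_value_def const_mat_mult has_value_minus)
  have "\<exists>M. mat_has_value X w M" for w
  proof (cases "norm w \<le> 1")
    case True
    show ?thesis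
      unfolding X_def
      by (rule exI, rule mat_has_value_mult[OF mat_has_value_const
            mat_has_value_inverse(2)[OF I stable_invertible_disc[OF A True]]])
  next
    case False
    then have "1 \<le> norm w" by simp
    note inv = stable_invertible_exterior[OF stable_adj[OF A] this]
    show ?thesis
      unfolding X_alt
      by (rule exI, rule mat_has_value_mult[OF mat_has_value_inverse(2)[OF J inv] AD])
  qed
  then have "\<not> rat_pole (X $ i $ j) w" for i j w
    unfolding rat_pole_iff mat_has_value_def by blast
  then have "\<exists>p. X $ i $ j = Fraction_Field.Fract p 1" for i j
    using ratfun_no_poles_imp_poly by metis
  then obtain P where P: "\<And>i j. X $ i $ j = Fraction_Field.Fract (P i j) 1" by metis
  define Y where "Y = (\<chi> i j. P i j)"
  have X: "mat_has_value X w (\<chi> i j. poly (Y $ i $ j) w)" for w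
    using has_valueI[of 1 w] by (simp add: mat_has_value_def P Y_def)
  have "Y = 0"
  proof (rule poly_matrix_shift_eq_zero[where M = "adj A" and N = "- (adj A ** \<Delta>)"])
    fix w
    let ?Y = "\<chi> i j. poly (Y $ i $ j) w"
    have "mat_has_value (?J ** X) w ((mat w - adj A) ** ?Y)"
      by (rule mat_has_value_mult[OF J X])
    moreover have "mat_has_value (?J ** X) w (- (adj A ** \<Delta>))"
      unfolding JX by (rule AD)
    ultimately have "(mat w - adj A) ** ?Y = - (adj A ** \<Delta>)" by (rule mat_has_value_unique)
    then show "mat w ** ?Y = adj A ** ?Y + - (adj A ** \<Delta>)"
      by (simp add: matrix_diff_distrib_right algebra_simps)
  qed
  then have "X = 0" by (simp add: vec_eq_iff P Y_def Zero_fract_def)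
  then have "const_mat \<Delta> = 0" using XI by simp
  then have "mat_has_value 0 0 \<Delta>" by (metis mat_has_value_const)
  then show "\<Delta> = 0"
    by (rule mat_has_value_unique) (simp add: mat_has_value_def has_value_0)
qed

lemma stein_solution_hermitian:
  assumes A: "stable A" and P: "P - adj A ** P ** A = adj C ** C"
  shows "adj P = P"
proof -
  have "adj P - adj A ** adj P ** A = adj C ** C"
    using arg_cong[OF P, of adj] by (simp add: adj_diff adj_mult matrix_mul_assoc)
  moreover have "(adj P - P) - adj A ** (adj P - P) ** A =
      (adj P - adj A ** adj P ** A) - (P - adj A ** P ** A)"
    by (simp only: matrix_distribs) simp
  ultimately have "(adj P - P) - adj A ** (adj P - P) ** A = 0"
    using P by simp
  then have "adj P - P = 0"
    by (intro stein_homogeneous[OF A]) (rule eq_iff_diff_eq_0[THEN iffD2])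
  then show ?thesis by simp
qed

section \<open>Gram matrices on the unit circle\<close>

lemma pos_def_invertible:
  assumes "pos_def M"
  shows "invertible M"
  unfolding invertible_iff_kernel
proof (intro allI impI)
  fix v assume "M *v v = 0"
  then have "\<not> 0 < Re (\<Sum>i\<in>UNIV. cnj (v $ i) * (M *v v) $ i)" by simp
  then show "v = 0" using assms unfolding pos_def_def by blast
qed

text \<open>
  The Gram computations use no other property of the unit circle.
\<close>

lemma mat_mult_unimodular:
  assumes "norm w = 1"
  shows "adj (mat w ** X) ** K ** (mat w ** Y) = adj X ** K ** Y"
proof -
  have "cnj w * w = 1"
    using assms by (metis complex_norm_square mult.commute of_real_1 power_one)
  moreover have "adj (mat w ** X) ** K ** (mat w ** Y) = mat (cnj w * w) ** (adj X ** K ** Y)"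
  proof -
    have "adj (mat w ** X) = mat (cnj w) ** adj X"
      by (simp add: adj_mult adj_mat mat_commute)
    moreover have "mat (cnj w) ** adj X ** K ** (mat w ** Y) =
        mat (cnj w) ** ((adj X ** K ** mat w) ** Y)"
      by (simp add: matrix_mul_assoc)
    moreover have "\<dots> = mat (cnj w) ** (mat w ** (adj X ** K ** Y))"
      by (simp only: mat_commute[of "adj X ** K" w]) (simp add: matrix_mul_assoc)
    moreover have "\<dots> = mat (cnj w * w) ** (adj X ** K ** Y)"
      by (simp add: vec_eq_iff mat_mult_nth)
    ultimately show ?thesis by metis
  qed
  ultimately show ?thesis by simp
qed

lemmas gram_expand = adj_add adj_diff adj_mult matrix_distribs matrix_mul_assoc

text \<open>
  Here \<open>y = w x\<close> is the state multiplied by \<open>w\<close>, so that \<open>R + C y\<close> is the value of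
  \<open>R + z C (I - z A)\<^sup>-\<^sup>1 B\<close>. The term \<open>y\<^sup>* C\<^sup>* C y\<close> is \<open>y\<^sup>* P y - (A y)\<^sup>* P (A y)\<close>, and
  \<open>y\<^sup>* P y = x\<^sup>* P x\<close> with \<open>x = B + A y\<close>; the difference has no quadratic part.
\<close>

lemma lossless_gram_causal:
  assumes w: "norm w = 1"
    and P: "P - adj A ** P ** A = adj C ** C" and herm: "adj P = P"
    and x: "x = B + A ** (mat w ** x)"
  defines "y \<equiv> mat w ** x"
  shows "adj (R + C ** y) ** (R + C ** y) =
    adj R ** R + adj B ** P ** B +
      ((adj R ** C + adj B ** P ** A) ** y + adj ((adj R ** C + adj B ** P ** A) ** y))"
proof -
  have "adj y ** P ** y = adj x ** P ** x"
    unfolding y_def by (rule mat_mult_unimodular[OF w])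
  also have "\<dots> = adj (B + A ** y) ** P ** (B + A ** y)"
    using x by (simp add: y_def)
  finally have "adj y ** P ** y = adj (B + A ** y) ** P ** (B + A ** y)" .
  moreover have "adj y ** (adj C ** C) ** y = adj y ** (P - adj A ** P ** A) ** y"
    by (simp only: P)
  ultimately show ?thesis
    by (simp add: gram_expand herm)
qed

text \<open>
  The counterpart for \<open>\<gamma> (z - \<alpha>)\<^sup>-\<^sup>1 \<beta>\<close>, where the state satisfies \<open>w x = \<alpha> x + \<beta>\<close>.
\<close>

lemma lossless_gram_anticausal:
  assumes w: "norm w = 1"
    and P: "P - adj \<alpha> ** P ** \<alpha> = adj \<gamma> ** \<gamma>" and herm: "adj P = P"
    and x: "mat w ** x = \<alpha> ** x + \<beta>"
  shows "adj (\<gamma> ** x) ** (\<gamma> ** x) =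
    adj \<beta> ** P ** \<beta> + (adj \<beta> ** P ** \<alpha> ** x + adj (adj \<beta> ** P ** \<alpha> ** x))"
proof -
  have "adj x ** P ** x = adj (\<alpha> ** x + \<beta>) ** P ** (\<alpha> ** x + \<beta>)"
    unfolding x[symmetric] by (rule mat_mult_unimodular[OF w, symmetric])
  moreover have "adj x ** (adj \<gamma> ** \<gamma>) ** x = adj x ** (P - adj \<alpha> ** P ** \<alpha>) ** x"
    by (simp only: P)
  ultimately show ?thesis
    by (simp add: gram_expand herm)
qed

text \<open>
  The causal and anticausal parts of \<open>G\<close> have the states \<open>x\<close> and \<open>u\<close>. The auxiliary state \<open>s\<close>
  obeys a recursion with matrix \<open>\<alpha>\<^sup>*\<close>, driven by \<open>\<gamma>\<^sup>*\<close> times the causal part and a constant;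
  pairing it with \<open>u\<close> turns the cross term \<open>(\<gamma> u)\<^sup>* (R + C (w x))\<close>, together with the linear
  term left over from the anticausal part, into \<open>\<beta>\<^sup>* (w s)\<close>. The pair of \<open>x\<close> and \<open>s\<close> is the
  state of the outer function.
\<close>

lemma two_sided_gram:
  assumes w: "norm w = 1"
    and Pp: "Pp - adj A ** Pp ** A = adj C ** C" and Pp_herm: "adj Pp = Pp"
    and Pm: "Pm - adj \<alpha> ** Pm ** \<alpha> = adj \<gamma> ** \<gamma>" and Pm_herm: "adj Pm = Pm"
    and x: "x = B + A ** (mat w ** x)"
    and u: "mat w ** u = \<alpha> ** u + \<beta>"
    and s: "s = adj \<gamma> ** R + adj \<alpha> ** Pm ** \<beta> + adj \<gamma> ** C ** (mat w ** x) + adj \<alpha> ** (mat w ** s)"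
  defines "G \<equiv> R + C ** (mat w ** x) + \<gamma> ** u"
    and "S \<equiv> (adj R ** C + adj B ** Pp ** A) ** (mat w ** x) + adj \<beta> ** (mat w ** s)"
  shows "adj G ** G = adj R ** R + adj B ** Pp ** B + adj \<beta> ** Pm ** \<beta> + (S + adj S)"
proof -
  define y t where "y = mat w ** x" and "t = mat w ** s"
  define H where "H = R + C ** y"
  have "adj (mat w ** u) ** mat 1 ** (mat w ** s) = adj u ** mat 1 ** s"
    by (rule mat_mult_unimodular[OF w])
  then have "adj (\<alpha> ** u + \<beta>) ** t = adj u ** s" by (simp add: u t_def)
  also have "\<dots> = adj u ** (adj \<gamma> ** R + adj \<alpha> ** Pm ** \<beta> + adj \<gamma> ** C ** y + adj \<alpha> ** t)"
    using s by (simp add: y_def t_def)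
  \<comment> \<open>The terms \<open>u\<^sup>* \<alpha>\<^sup>* t\<close> on both sides cancel.\<close>
  finally have T: "adj \<beta> ** t = adj (\<gamma> ** u) ** H + adj (adj \<beta> ** Pm ** \<alpha> ** u)"
    by (simp add: gram_expand Pm_herm H_def)
  have T': "adj (adj \<beta> ** t) = adj H ** (\<gamma> ** u) + adj \<beta> ** Pm ** \<alpha> ** u"
    unfolding T by (simp add: adj_add adj_mult matrix_mul_assoc)
  have "adj G ** G = adj H ** H + adj (\<gamma> ** u) ** (\<gamma> ** u) + adj (\<gamma> ** u) ** H + adj H ** (\<gamma> ** u)"
    unfolding G_def y_def[symmetric] H_def[symmetric]
    by (simp add: adj_add matrix_distribs)
  also have "adj H ** H = adj R ** R + adj B ** Pp ** B +
      ((adj R ** C + adj B ** Pp ** A) ** y + adj ((adj R ** C + adj B ** Pp ** A) ** y))"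
    unfolding H_def y_def by (rule lossless_gram_causal[OF w Pp Pp_herm x])
  also have "adj (\<gamma> ** u) ** (\<gamma> ** u) =
      adj \<beta> ** Pm ** \<beta> + (adj \<beta> ** Pm ** \<alpha> ** u + adj (adj \<beta> ** Pm ** \<alpha> ** u))"
    by (rule lossless_gram_anticausal[OF w Pm Pm_herm u])
  finally show ?thesis
    unfolding S_def y_def[symmetric] t_def[symmetric] adj_add
    by (subst T', subst T) (simp only: add_ac)
qed

text \<open>
  The Riccati equation replaces the quadratic term \<open>y\<^sup>* C\<^sub>0\<^sup>* D\<^sup>-\<^sup>2 C\<^sub>0 y\<close> in
  \<open>y = w x\<close> by \<open>y\<^sup>* Q y - (At\<^sup>* y)\<^sup>* Q (At\<^sup>* y)\<close>, whose quadratic part cancels by the recursion of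
  \<open>x\<close>, as for the Stein equation.
\<close>

lemma spectral_factor_gram:
  assumes w: "norm w = 1"
    and Q_herm: "adj Q = Q"
    and D_herm: "adj D = D" and D_inv: "invertible D"
    and DD: "D ** D = Dt - Ct ** Q ** adj Ct"
    and ricc: "Q - At ** Q ** adj At = adj C0 ** matrix_inv (D ** D) ** C0"
    and C0: "C0 = adj Bt - Ct ** Q ** adj At"
    and x: "x = adj Ct + adj At ** (mat w ** x)"
  defines "G \<equiv> D + matrix_inv D ** C0 ** (mat w ** x)"
    and "S \<equiv> adj Bt ** (mat w ** x)"
  shows "adj G ** G = Dt + (S + adj S)"
proof -
  define y where "y = mat w ** x"
  have invh: "adj (matrix_inv D) = matrix_inv D"
    using matrix_inv_eqI(2)[of "adj (matrix_inv D)" D] D_herm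
    by (metis D_inv adj_mat adj_mult complex_cnj_one matrix_inv_mult(1))
  have invDD: "matrix_inv (D ** D) = matrix_inv D ** matrix_inv D"
    using D_inv D_inv by (rule matrix_inv_of_mult)
  have D1: "D ** (matrix_inv D ** C0 ** y) = C0 ** y"
    by (simp add: matrix_mul_assoc matrix_inv_mult[OF D_inv])
  have D2: "adj (matrix_inv D ** C0 ** y) ** D = adj (C0 ** y)"
    using arg_cong[OF D1, of adj] by (simp add: adj_mult D_herm)
  have D3: "adj (matrix_inv D ** C0 ** y) ** (matrix_inv D ** C0 ** y) =
      adj y ** (Q - At ** Q ** adj At) ** y"
    by (simp add: ricc invDD adj_mult invh matrix_mul_assoc)
  have "adj y ** Q ** y = adj x ** Q ** x"
    unfolding y_def by (rule mat_mult_unimodular[OF w])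
  also have "\<dots> = adj (adj Ct + adj At ** y) ** Q ** (adj Ct + adj At ** y)"
    using x by (simp add: y_def)
  finally have Qy: "adj y ** Q ** y = adj (adj Ct + adj At ** y) ** Q ** (adj Ct + adj At ** y)" .
  have "adj G ** G = D ** D + D ** (matrix_inv D ** C0 ** y) + adj (matrix_inv D ** C0 ** y) ** D
      + adj (matrix_inv D ** C0 ** y) ** (matrix_inv D ** C0 ** y)"
    unfolding G_def y_def[symmetric] adj_add matrix_distribs D_herm
    by (simp only: add_ac)
  also have "\<dots> = Dt - Ct ** Q ** adj Ct + C0 ** y + adj (C0 ** y)
      + adj y ** (Q - At ** Q ** adj At) ** y"
    unfolding D1 D2 D3 DD ..
  also have "\<dots> = Dt + (adj Bt ** y + adj (adj Bt ** y))"
    using Qy by (simp add: C0 gram_expand Q_herm)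
  finally show ?thesis unfolding S_def y_def .
qed

lemma unitary_quotient:
  fixes M N :: "complex^'m^'m"
  assumes "adj N ** N = adj M ** M" and M: "invertible M"
  shows "unitary (N ** matrix_inv M)"
proof -
  have "adj (N ** matrix_inv M) ** (N ** matrix_inv M) =
      adj (matrix_inv M) ** (adj N ** N) ** matrix_inv M"
    by (simp add: adj_mult matrix_mul_assoc)
  also have "\<dots> = adj (M ** matrix_inv M) ** (M ** matrix_inv M)"
    unfolding assms(1) by (simp add: adj_mult matrix_mul_assoc)
  also have "\<dots> = mat 1" by (simp add: matrix_inv_mult[OF M] adj_mat)
  finally show ?thesis
    unfolding unitary_def using matrix_left_right_inverse by blast
qed

section \<open>Zeros of the outer function\<close>

lemma resolvent_fixpoint:
  fixes M :: "complex^'n^'n" and N X :: "complex^'k^'n"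
  assumes inv: "invertible (mat 1 - mat w ** M)"
  shows "X = matrix_inv (mat 1 - mat w ** M) ** N \<longleftrightarrow> X = N + M ** (mat w ** X)"
proof -
  let ?F = "mat 1 - mat w ** M"
  have "M ** (mat w ** X) = mat w ** M ** X"
    by (simp add: matrix_mul_assoc mat_commute)
  then have "X = N + M ** (mat w ** X) \<longleftrightarrow> ?F ** X = N"
    by (auto simp: matrix_diff_distrib_right diff_eq_eq)
  also have "\<dots> \<longleftrightarrow> X = matrix_inv ?F ** N"
    by (metis inv matrix_inv_mult matrix_mul_assoc matrix_mul_lid)
  finally show ?thesis by simp
qed

text \<open>
  Let \<open>v\<close> be in the kernel and let \<open>\<xi> = X v\<close> be the corresponding state. The kernel equation
  expresses \<open>v\<close> as the feedback \<open>- D\<^sup>-\<^sup>2 H (w \<xi>)\<close>; substituted into \<open>\<xi> = G v + F (w \<xi>)\<close> it makes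
  \<open>\<xi>\<close> a fixed point of \<open>w\<close> times the closed-loop matrix, so \<open>\<xi> = 0\<close> and then \<open>v = 0\<close>.
\<close>

lemma outer_value_invertible:
  fixes D :: "complex^'m^'m" and F :: "complex^'n^'n" and G X :: "complex^'m^'n" and H :: "complex^'n^'m"
  assumes st: "stable (F - G ** matrix_inv (D ** D) ** H)" and D: "invertible D"
    and w: "norm w \<le> 1" and X: "X = G + F ** (mat w ** X)"
  shows "invertible (D + matrix_inv D ** H ** (mat w ** X))"
  unfolding invertible_iff_kernel
proof (intro allI impI)
  fix v assume v: "(D + matrix_inv D ** H ** (mat w ** X)) *v v = 0"
  define \<xi> where "\<xi> = X *v v"
  define y where "y = w *s \<xi>"
  have wX: "mat w *v (X *v v) = y"
    by (simp add: y_def \<xi>_def mat_mult_vec)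
  have "D *v v + matrix_inv D *v (H *v y) = 0"
    using v by (simp add: matrix_vector_mult_add_rdistrib matrix_vector_mul_assoc[symmetric] wX)
  then have "matrix_inv D *v (D *v v + matrix_inv D *v (H *v y)) = 0" by simp
  then have "v + matrix_inv (D ** D) *v (H *v y) = 0"
    by (simp add: matrix_vector_right_distrib matrix_vector_mul_assoc matrix_mul_assoc
        matrix_inv_mult[OF D] matrix_inv_of_mult[OF D D])
  then have v': "v = - (matrix_inv (D ** D) *v (H *v y))" by (simp add: eq_neg_iff_add_eq_0)
  have "\<xi> = G *v v + F *v y"
    unfolding \<xi>_def
    by (subst X) (simp add: matrix_vector_mult_add_rdistrib matrix_vector_mul_assoc[symmetric] wX)
  also have "\<dots> = (F - G ** matrix_inv (D ** D) ** H) *v y"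
    by (subst v') (simp add: matrix_vector_mult_diff_rdistrib matrix_vector_mul_assoc[symmetric]
        vec.neg)
  also have "\<dots> = w *s ((F - G ** matrix_inv (D ** D) ** H) *v \<xi>)"
    unfolding y_def by (rule vector_scalar_commute)
  finally have "\<xi> = 0" by (rule stable_fixpoint_zero[OF st w])
  then show "v = 0" using v' by (simp add: y_def)
qed

section \<open>Wiener-Hopf indices and outer right factors\<close>

lemma no_poles_zeros_onI:
  assumes "S \<noteq> {}" and "\<And>w. w \<in> S \<Longrightarrow> \<exists>M. mat_has_value F w M \<and> invertible M"
  shows "no_poles_zeros_on F S"
  unfolding no_poles_zeros_on_def mat_zero_def mat_pole_iff
  using assms mat_has_value_inverse by (metis ex_in_conv)

lemma no_poles_zeros_on_mult:
  assumes "no_poles_zeros_on F S" "no_poles_zeros_on G S"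
  shows "no_poles_zeros_on (F ** G) S"
proof -
  have inv: "invertible F" "invertible G" using assms by (auto simp: no_poles_zeros_on_def)
  then have "invertible (F ** G)" by (rule invertible_mult)
  then show ?thesis
    using assms unfolding no_poles_zeros_on_def mat_zero_def mat_pole_iff
    by (metis mat_has_value_mult matrix_inv_of_mult[OF inv])
qed

lemma no_poles_zeros_on_inverse:
  "no_poles_zeros_on F S \<Longrightarrow> no_poles_zeros_on (matrix_inv F) S"
  by (auto simp: no_poles_zeros_on_def mat_zero_def invertible_matrix_inv)

text \<open>
  The factor \<open>G\<close> is absorbed into \<open>W\<^sub>+\<close>.
\<close>

lemma right_WH_indices_mult_outer:
  assumes "no_poles_zeros_on G {z. norm z \<le> 1}" and "right_WH_indices F as ws"
  shows "right_WH_indices (F ** G) as ws"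
proof -
  obtain k Wm Wp and pos :: "'a \<Rightarrow> nat" where wh:
    "CARD('a) = length as + k + length ws" "bij_betw pos UNIV {..<CARD('a)}"
    "no_poles_zeros_on Wm {z. 1 \<le> norm z}" "no_poles_zeros_inf Wm"
    "no_poles_zeros_on Wp {z. norm z \<le> 1}"
    "F = Wm ** wh_diag pos (map uminus as @ replicate k 0 @ rev ws) ** Wp"
    using assms(2) unfolding right_WH_indices_def by blast
  have "no_poles_zeros_on (Wp ** G) {z. norm z \<le> 1}"
    by (rule no_poles_zeros_on_mult[OF wh(5) assms(1)])
  moreover have "F ** G = Wm ** wh_diag pos (map uminus as @ replicate k 0 @ rev ws) ** (Wp ** G)"
    by (simp add: wh(6) matrix_mul_assoc)
  ultimately show ?thesis
    using assms(2) wh(1-4) unfolding right_WH_indices_def by blast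
qed

lemma right_WH_indices_mult_outer_iff:
  assumes G: "no_poles_zeros_on G {z. norm z \<le> 1}"
  shows "right_WH_indices (F ** G) as ws \<longleftrightarrow> right_WH_indices F as ws"
proof
  assume "right_WH_indices (F ** G) as ws"
  then have "right_WH_indices (F ** G ** matrix_inv G) as ws"
    by (rule right_WH_indices_mult_outer[OF no_poles_zeros_on_inverse[OF G]])
  moreover have "F ** G ** matrix_inv G = F"
    using G by (simp add: no_poles_zeros_on_def matrix_inv_mult matrix_mul_assoc[symmetric])
  ultimately show "right_WH_indices F as ws" by simp
qed (rule right_WH_indices_mult_outer[OF G])

section \<open>The unimodular quotient\<close>

theorem lemma3p1:
  fixes R0 :: "complex^'m^'m"
    and A :: "complex^'n^'n" and B :: "complex^'m^'n" and C :: "complex^'n^'m"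
    and \<alpha> :: "complex^'p^'p" and \<beta> :: "complex^'m^'p" and \<gamma> :: "complex^'p^'m"
    and Pp :: "complex^'n^'n" and Pm :: "complex^'p^'p"
    and At Q :: "complex^('n + 'p)^('n + 'p)"
    and Bt B0 :: "complex^'m^('n + 'p)"
    and Ct C0 :: "complex^('n + 'p)^'m"
    and Dt D :: "complex^'m^'m"
    and R \<Psi> \<Xi> :: "ratfun^'m^'m"
  assumes R_def: "R = realization_fun R0 A B C \<alpha> \<beta> \<gamma>"
    and A_stable: "stable A" and \<alpha>_stable: "stable \<alpha>"
    and R_circle: "no_poles_zeros_on R {z. norm z = 1}"
    and Pp: "Pp - adj A ** Pp ** A = adj C ** C"
    and Pm: "Pm - adj \<alpha> ** Pm ** \<alpha> = adj \<gamma> ** \<gamma>"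
    and At_def: "At = block_mat (adj A) (adj C ** \<gamma>) 0 \<alpha>"
    and Bt_def: "Bt = block_col (adj C ** R0 + adj A ** Pp ** B) \<beta>"
    and Ct_def: "Ct = block_row (adj B) (adj R0 ** \<gamma> + adj \<beta> ** Pm ** \<alpha>)"
    and Dt_def: "Dt = adj R0 ** R0 + adj B ** Pp ** B + adj \<beta> ** Pm ** \<beta>"
    and Q: "stabilizing_solution At Bt Ct Dt Q"
    and D: "pos_def D" "D ** D = Dt - Ct ** Q ** adj Ct"
    and C0_def: "C0 = adj Bt - Ct ** Q ** adj At"
    and B0_def: "B0 = adj Ct"
    and \<Psi>_def: "\<Psi> = outer_fun D C0 At B0"
    and \<Xi>_def: "\<Xi> = R ** matrix_inv \<Psi>"
  shows "(\<forall>z. norm z = 1 \<longrightarrow> \<not> mat_pole \<Xi> z \<and> unitary (mat_eval \<Xi> z)) \<and>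
         (\<forall>as ws. right_WH_indices R as ws \<longleftrightarrow> right_WH_indices \<Xi> as ws)"
proof -
  have D_inv: "invertible D" by (rule pos_def_invertible[OF D(1)])
  have D_herm: "adj D = D" using D(1) by (simp add: pos_def_def hermitian_def)
  have Q_herm: "adj Q = Q" using Q by (simp add: stabilizing_solution_def hermitian_def)
  have C0_adj: "adj C0 = Bt - At ** Q ** adj Ct"
    by (simp add: C0_def adj_diff adj_mult Q_herm matrix_mul_assoc)
  have ricc: "Q - At ** Q ** adj At = adj C0 ** matrix_inv (D ** D) ** C0"
    using Q unfolding stabilizing_solution_def C0_adj unfolding C0_def D(2) by blast
  have closed_loop: "stable (adj At - adj Ct ** matrix_inv (D ** D) ** C0)"
    using Q unfolding stabilizing_solution_def C0_def D(2) by blast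
  have Pp_herm: "adj Pp = Pp" by (rule stein_solution_hermitian[OF A_stable Pp])
  have Pm_herm: "adj Pm = Pm" by (rule stein_solution_hermitian[OF \<alpha>_stable Pm])
  have At_stable: "stable (adj At)"
    unfolding At_def by (intro stable_adj stable_block_triangular A_stable \<alpha>_stable)
  have adj_At: "adj At = block_mat A 0 (adj \<gamma> ** C) (adj \<alpha>)"
    by (simp add: At_def adj_block_mat adj_mult)
  have adj_Bt: "adj Bt = block_row (adj R0 ** C + adj B ** Pp ** A) (adj \<beta>)"
    by (simp add: Bt_def adj_block_col adj_add adj_mult matrix_mul_assoc Pp_herm)
  have adj_Ct: "adj Ct = block_col B (adj \<gamma> ** R0 + adj \<alpha> ** Pm ** \<beta>)"
    by (simp add: Ct_def adj_block_row adj_add adj_mult matrix_mul_assoc Pm_herm)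

  define X where "X w = matrix_inv (mat 1 - mat w ** adj At) ** adj Ct" for w
  define \<Psi>v where "\<Psi>v w = D + matrix_inv D ** C0 ** (mat w ** X w)" for w
  have X: "X w = adj Ct + adj At ** (mat w ** X w)" if "norm w \<le> 1" for w
    using resolvent_fixpoint[OF stable_invertible_disc[OF At_stable that]] X_def by blast
  have \<Psi>v: "mat_has_value \<Psi> w (\<Psi>v w)" if "norm w \<le> 1" for w
  proof -
    have "mat_has_value (mat 1 - mat ratz ** const_mat (adj At)) w (mat 1 - mat w ** adj At)"
      by (intro mat_has_value_diff mat_has_value_mult mat_has_value_1 mat_has_value_ratz
          mat_has_value_const)
    note inv = mat_has_value_inverse(2)[OF this stable_invertible_disc[OF At_stable that]]
    have "mat_has_value \<Psi> w (D + mat w ** matrix_inv D ** C0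
        ** matrix_inv (mat 1 - mat w ** adj At) ** adj Ct)"
      unfolding \<Psi>_def outer_fun_def B0_def
      by (intro mat_has_value_add mat_has_value_mult mat_has_value_ratz mat_has_value_const inv)
    moreover have "mat w ** matrix_inv D ** C0 = matrix_inv D ** C0 ** mat w"
      by (simp add: mat_commute matrix_mul_assoc)
    ultimately show ?thesis by (simp add: \<Psi>v_def X_def matrix_mul_assoc)
  qed
  have \<Psi>v_inv: "invertible (\<Psi>v w)" if "norm w \<le> 1" for w
    unfolding \<Psi>v_def by (rule outer_value_invertible[OF closed_loop D_inv that X[OF that]])
  have outer: "no_poles_zeros_on \<Psi> {z. norm z \<le> 1}"
  proof (rule no_poles_zeros_onI)
    show "{z :: complex. norm z \<le> 1} \<noteq> {}" by (auto intro: exI[of _ 0])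
  qed (use \<Psi>v \<Psi>v_inv in auto)

  have unit: "\<not> mat_pole \<Xi> w \<and> unitary (mat_eval \<Xi> w)" if w: "norm w = 1" for w
  proof -
    have w1: "norm w \<le> 1" "1 \<le> norm w" using w by auto
    define x where "x = matrix_inv (mat 1 - mat w ** A) ** B"
    define u where "u = matrix_inv (mat w - \<alpha>) ** \<beta>"
    define s where "s = matrix_inv (mat 1 - mat w ** adj \<alpha>) **
        (adj \<gamma> ** R0 + adj \<alpha> ** Pm ** \<beta> + adj \<gamma> ** C ** (mat w ** x))"
    note invA = stable_invertible_disc[OF A_stable w1(1)]
    note inv\<alpha> = stable_invertible_exterior[OF \<alpha>_stable w1(2)]
    have x: "x = B + A ** (mat w ** x)"
      using resolvent_fixpoint[OF invA] x_def by blast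
    have s: "s = adj \<gamma> ** R0 + adj \<alpha> ** Pm ** \<beta> + adj \<gamma> ** C ** (mat w ** x) + adj \<alpha> ** (mat w ** s)"
      using resolvent_fixpoint[OF stable_invertible_disc[OF stable_adj[OF \<alpha>_stable] w1(1)]] s_def
      by blast
    have "(mat w - \<alpha>) ** u = \<beta>"
      by (simp add: u_def matrix_mul_assoc matrix_inv_mult[OF inv\<alpha>])
    then have u: "mat w ** u = \<alpha> ** u + \<beta>" by (simp add: matrix_diff_distrib_right diff_eq_eq add.commute)
    \<comment> \<open>The matrix \<open>At\<^sup>*\<close> is block lower triangular, so the first component of the state of \<open>\<Psi>\<close>
      is the state of the causal part of \<open>R\<close>, and the second is the auxiliary state of the
      Gram computation.\<close>
    have "block_col x s = adj Ct + adj At ** (mat w ** block_col x s)"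
      unfolding adj_At adj_Ct mult_block_col block_mat_mult_col block_col_add
      using x s by (simp add: add.assoc)
    then have X_block: "X w = block_col x s"
      using resolvent_fixpoint[OF stable_invertible_disc[OF At_stable w1(1)]] X_def by metis
    define Rv where "Rv = R0 + C ** (mat w ** x) + \<gamma> ** u"
    have Rv: "mat_has_value R w Rv"
    proof -
      have "mat_has_value (mat 1 - mat ratz ** const_mat A) w (mat 1 - mat w ** A)"
        by (intro mat_has_value_diff mat_has_value_mult mat_has_value_1 mat_has_value_ratz
            mat_has_value_const)
      note i1 = mat_has_value_inverse(2)[OF this invA]
      have "mat_has_value (mat ratz - const_mat \<alpha>) w (mat w - \<alpha>)"
        by (intro mat_has_value_diff mat_has_value_ratz mat_has_value_const)
      note i2 = mat_has_value_inverse(2)[OF this inv\<alpha>]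
      have "mat_has_value R w (R0 + mat w ** C ** matrix_inv (mat 1 - mat w ** A) ** B
          + \<gamma> ** matrix_inv (mat w - \<alpha>) ** \<beta>)"
        unfolding R_def realization_fun_def
        by (intro mat_has_value_add mat_has_value_mult mat_has_value_ratz mat_has_value_const i1 i2)
      then show ?thesis
        by (simp add: Rv_def x_def u_def mat_commute matrix_mul_assoc)
    qed
    have "adj Rv ** Rv = Dt + (adj Bt ** (mat w ** X w) + adj (adj Bt ** (mat w ** X w)))"
      unfolding Rv_def Dt_def X_block adj_Bt mult_block_col block_row_mult_col
      by (rule two_sided_gram[OF w Pp Pp_herm Pm Pm_herm x u s])
    also have "\<dots> = adj (\<Psi>v w) ** \<Psi>v w"
      unfolding \<Psi>v_def
      by (rule spectral_factor_gram[OF w Q_herm D_herm D_inv D(2) ricc C0_def X[OF w1(1)], symmetric])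
    finally have gram: "adj Rv ** Rv = adj (\<Psi>v w) ** \<Psi>v w" .
    have "mat_has_value \<Xi> w (Rv ** matrix_inv (\<Psi>v w))"
      unfolding \<Xi>_def
      by (intro mat_has_value_mult Rv mat_has_value_inverse(2)[OF \<Psi>v] \<Psi>v_inv w1)
    then show ?thesis
      using unitary_quotient[OF gram \<Psi>v_inv[OF w1(1)]] mat_eval_eqI mat_pole_iff by metis
  qed
  have "right_WH_indices R as ws \<longleftrightarrow> right_WH_indices \<Xi> as ws" for as ws
    unfolding \<Xi>_def
    by (rule right_WH_indices_mult_outer_iff[OF no_poles_zeros_on_inverse[OF outer], symmetric])
  with unit show ?thesis by blast
qed

end
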